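(* Let $A$ be a set and let $\mathrel{\vdash\!\dashv}$, $\to$, $\leadsto$ be binary relations on $A$ such that $\mathrel{\vdash\!\dashv}$ is symmetric, ${\leadsto} \subseteq {\mathrel{\vdash\!\dashv}}$, and the relation ${\to} \circ {\stackrel{*}{\leadsto}}$ is well-founded. Let ${\Rightarrow} = {\leadsto} \cup {\to}$. Suppose (i) ${\gets} \circ {\to} \subseteq {\stackrel{*}{\Rightarrow}} \circ {\stackrel{=}{\vdash\!\dashv}} \circ {\stackrel{*}{\Leftarrow}}$, and (ii) ${\mathrel{\vdash\!\dashv}} \circ {\to} \subseteq ({\stackrel{=}{\vdash\!\dashv}} \circ {\stackrel{*}{\Leftarrow}}) \cup ({\to} \circ {\stackrel{*}{\Rightarrow}} \circ {\stackrel{=}{\vdash\!\dashv}} \circ {\stackrel{*}{\Leftarrow}})$. Then $\to$ is Church-Rosser modulo $\stackrel{*}{\vdash\!\dashv}$.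
   Context: For a relation $R$ on $A$: $R^{-1}$ (written with a reversed arrow, e.g. $\gets$, $\Leftarrow$) is its inverse; $\stackrel{=}{R}$ its reflexive closure; $\stackrel{+}{R}$ its transitive closure; $\stackrel{*}{R}$ its reflexive-transitive closure. Composition: $a \,(R\circ S)\, c$ iff there is $b$ with $a\,R\,b$ and $b\,S\,c$. For relations $R,S$, $R\subseteq S$ means $a\,R\,b$ implies $a\,S\,b$. A relation $R$ is well-founded if there is no infinite chain $a_0\,R\,a_1\,R\,a_2\cdots$. Given an equivalence relation $\sim$ on $A$, a relation $\to$ is Church-Rosser modulo $\sim$ if $\stackrel{*}{\bowtie} \subseteq \stackrel{*}{\to}\circ \sim \circ \stackrel{*}{\gets}$, where ${\bowtie} = {\leftrightarrow} \cup {\sim}$ and $\leftrightarrow$ is the symmetric closure of $\to$. Note that $\stackrel{*}{\vdash\!\dashv}$ (reflexive-transitive closure of the symmetric relation $\mathrel{\vdash\!\dashv}$) is an equivalence relation. *)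

theory Defs
  imports Main
begin

text \<open>Relations on a set \<open>A\<close> are elements of \<open>('a \<times> 'a) set\<close>, with the type \<open>'a\<close> in the
  role of \<open>A\<close>.\<close>

text \<open>The chains ascend along \<open>R\<close>, so the library's \<^const>\<open>wf\<close> has to be applied to the converse
  (lemma \<open>well_founded_iff_wf_converse\<close>).\<close>

definition well_founded :: "('a \<times> 'a) set \<Rightarrow> bool" where
  "well_founded R \<longleftrightarrow> \<not> (\<exists>f :: nat \<Rightarrow> 'a. \<forall>i. (f i, f (Suc i)) \<in> R)"

lemma well_founded_iff_wf_converse: "well_founded R \<longleftrightarrow> wf (R\<inverse>)"
  by (simp add: well_founded_def wf_iff_no_infinite_down_chain)

text \<open>\<open>E\<close> is meant to be an equivalence relation. In its only use below it is the
  reflexive-transitive closure of a symmetric relation, see \<open>equiv_rtrancl_of_sym\<close>.\<close>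

definition church_rosser_modulo :: "('a \<times> 'a) set \<Rightarrow> ('a \<times> 'a) set \<Rightarrow> bool" where
  "church_rosser_modulo R E \<longleftrightarrow> ((R \<union> R\<inverse>) \<union> E)\<^sup>* \<subseteq> R\<^sup>* O E O (R\<inverse>)\<^sup>*"

lemma equiv_rtrancl_of_sym: "sym H \<Longrightarrow> equiv UNIV (H\<^sup>*)"
  by (simp add: equiv_def refl_rtrancl sym_rtrancl trans_rtrancl)

end

theory Submission
  imports Defs "HOL-Library.Multiset"
begin

text \<open>Let \<open>y < x\<close> mean that \<open>x\<close> reaches \<open>y\<close> by a sequence of \<open>S\<close>- and \<open>R\<close>-steps beginning
  with an \<open>R\<close>-step; this order is well-founded. Weigh a conversion by the multiset of the labels
  of its steps, where an \<open>R\<close>-step is labelled by its source and an \<open>H\<close>-step by the multiset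
  of its two ends. Assumptions (i) and (ii) replace a peak \<open>b \<leftarrow> a \<rightarrow> c\<close> or a cliff
  \<open>a H b \<rightarrow> c\<close> by a conversion of smaller weight. The \<open>S\<close>-steps of the new conversion may
  simply count as \<open>H\<close>-steps, because their ends lie strictly below \<open>a\<close> or \<open>b\<close>. A conversion
  without peaks and cliffs has the desired form.\<close>

section \<open>Labelled conversions\<close>

inductive step :: "('a \<times> 'a) set \<Rightarrow> ('a \<times> 'a) set \<Rightarrow> 'a multiset \<Rightarrow> 'a \<Rightarrow> 'a \<Rightarrow> bool"
  for H R where
  forward: "(a, b) \<in> R \<Longrightarrow> step H R {#a#} a b"
| backward: "(b, a) \<in> R \<Longrightarrow> step H R {#b#} a b"
| equational: "(a, b) \<in> H \<Longrightarrow> step H R {#a, b#} a b"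

inductive conv :: "('a \<times> 'a) set \<Rightarrow> ('a \<times> 'a) set \<Rightarrow> 'a multiset multiset \<Rightarrow> 'a \<Rightarrow> 'a \<Rightarrow> bool"
  for H R where
  refl: "conv H R {#} a a"
| step: "step H R L a b \<Longrightarrow> conv H R M b c \<Longrightarrow> conv H R (add_mset L M) a c"

lemma conv_single: "step H R L a b \<Longrightarrow> conv H R {#L#} a b"
  using conv.step conv.refl by fastforce

lemma conv_trans: "conv H R M a b \<Longrightarrow> conv H R N b c \<Longrightarrow> conv H R (M + N) a c"
  by (induction rule: conv.induct) (auto intro: conv.step)

text \<open>Labels ignore the direction of travel: an \<open>R\<close>-step keeps its source, and an
  \<open>H\<close>-step an unordered pair. Hence a reversed conversion has the same weight, and
  mirror images of peaks and cliffs need no separate treatment.\<close>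

lemma step_sym: "sym H \<Longrightarrow> step H R L a b \<Longrightarrow> step H R L b a"
  by (erule step.cases)
    (auto intro: step.forward step.backward
      intro!: step.equational[of b a H R, unfolded add_mset_commute[of b a]] dest: symD)

lemma conv_sym: "sym H \<Longrightarrow> conv H R M a b \<Longrightarrow> conv H R M b a"
proof (rotate_tac, induction rule: conv.induct)
  case (refl a)
  then show ?case by (simp add: conv.refl)
next
  case (step L a b M c)
  then show ?case
    using conv_trans[OF _ conv_single[OF step_sym]] by fastforce
qed

lemma conv_if_convertible:
  assumes "(a, b) \<in> (R \<union> R\<inverse> \<union> H\<^sup>*)\<^sup>*"
  shows "\<exists>M. conv H R M a b"
proof -
  \<comment> \<open>Only single \<open>H\<close>-steps carry labels, so each
    \<open>H\<^sup>*\<close>-step is first split into them.\<close>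
  have "(R \<union> R\<inverse> \<union> H\<^sup>*)\<^sup>* = (R \<union> R\<inverse> \<union> H)\<^sup>*"
    by (rule rtrancl_subset) (auto intro: rtrancl_mono[THEN subsetD, of H])
  with assms have "(a, b) \<in> (R \<union> R\<inverse> \<union> H)\<^sup>*" by simp
  then show ?thesis
  proof (induction rule: converse_rtrancl_induct)
    case base
    then show ?case by (intro exI) (rule conv.refl)
  next
    case (step x y)
    then obtain M where "conv H R M y b" by blast
    moreover from step(1) obtain L where "step H R L x y"
      by (auto intro: step.intros)
    ultimately show ?case using conv.step by metis
  qed
qed

locale peaks_and_cliffs =
  fixes H R S :: "('a \<times> 'a) set"
  assumes sym_H: "sym H"
    and S_sub_H: "S \<subseteq> H"
    and well_founded_RS: "well_founded (R O S\<^sup>*)"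
    and peak: "R\<inverse> O R \<subseteq> (S \<union> R)\<^sup>* O H\<^sup>= O ((S \<union> R)\<inverse>)\<^sup>*"
    and cliff: "H O R \<subseteq> (H\<^sup>= O ((S \<union> R)\<inverse>)\<^sup>*) \<union> (R O (S \<union> R)\<^sup>* O H\<^sup>= O ((S \<union> R)\<inverse>)\<^sup>*)"
begin

section \<open>The orders on elements, labels and weights\<close>

definition below :: "('a \<times> 'a) set" where
  "below = ((R O S\<^sup>*)\<inverse>)\<^sup>+"

abbreviation below_weight :: "('a multiset multiset \<times> 'a multiset multiset) set" where
  "below_weight \<equiv> mult (mult below)"

lemma wf_below: "wf below"
  using well_founded_RS by (simp add: below_def well_founded_iff_wf_converse wf_trancl)

lemma trans_below: "trans below"
  by (simp add: below_def)

lemma wf_below_weight: "wf below_weight"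
  by (intro wf_mult wf_below)

lemma R_below: "(x, y) \<in> R \<Longrightarrow> (y, x) \<in> below"
  unfolding below_def by (rule r_into_trancl) auto

lemma below_S: "(y, x) \<in> below \<Longrightarrow> (y, z) \<in> S \<Longrightarrow> (z, x) \<in> below"
  unfolding below_def
\<comment> \<open>Owing to the converse, the first link from \<open>y\<close> is the last round of
  the descent from \<open>x\<close>; its \<open>S\<^sup>*\<close> tail absorbs the step to
  \<open>z\<close>.\<close>
proof (erule converse_tranclE)
  assume "(y, z) \<in> S" "(y, x) \<in> (R O S\<^sup>*)\<inverse>"
  then have "(z, x) \<in> (R O S\<^sup>*)\<inverse>" by (auto intro: rtrancl_into_rtrancl)
  then show "(z, x) \<in> ((R O S\<^sup>*)\<inverse>)\<^sup>+" by blast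
next
  fix w assume "(y, z) \<in> S" "(y, w) \<in> (R O S\<^sup>*)\<inverse>" "(w, x) \<in> ((R O S\<^sup>*)\<inverse>)\<^sup>+"
  then have "(z, w) \<in> (R O S\<^sup>*)\<inverse>" by (auto intro: rtrancl_into_rtrancl)
  then show "(z, x) \<in> ((R O S\<^sup>*)\<inverse>)\<^sup>+"
    using \<open>(w, x) \<in> _\<close> by (rule trancl_into_trancl2)
qed

lemma below_steps:
  assumes "(c, x) \<in> below" "(c, d) \<in> (S \<union> R)\<^sup>*"
  shows "(d, x) \<in> below"
  using assms(2,1)
  by (induction rule: rtrancl_induct) (auto intro: below_S R_below transD[OF trans_below])

lemma label_below:
  "X \<noteq> {#} \<Longrightarrow> \<forall>y\<in>#L. \<exists>x\<in>#X. (y, x) \<in> below \<Longrightarrow> (L, X) \<in> mult below"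
  using one_step_implies_mult[of X L below "{#}"] by simp

lemma weight_below:
  "N \<noteq> {#} \<Longrightarrow> \<forall>L\<in>#M. \<exists>X\<in>#N. (L, X) \<in> mult below \<Longrightarrow> (M, N) \<in> below_weight"
  using one_step_implies_mult[of N M "mult below" "{#}"] by simp

text \<open>Cancelling \<open>K\<close> requires the order on labels to be transitive, as
  \<open>mult\<close> is by construction, and irreflexive, which follows from
  well-foundedness.\<close>

lemma below_weight_add: "(M, N) \<in> below_weight \<Longrightarrow> (M + K, N + K) \<in> below_weight"
  by (subst mult_cancel)
    (auto simp: mult_def irrefl_on_def intro: wf_mult[OF wf_below, unfolded mult_def, THEN wf_irrefl])

section \<open>Conversions with bounded labels\<close>

definition conv_below :: "'a multiset \<Rightarrow> 'a \<Rightarrow> 'a \<Rightarrow> bool" where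
  "conv_below X a b \<longleftrightarrow> (\<exists>M. conv H R M a b \<and> (\<forall>L\<in>#M. (L, X) \<in> mult below))"

lemma conv_below_refl: "conv_below X a a"
  unfolding conv_below_def using conv.refl by fastforce

lemma conv_below_step: "step H R L a b \<Longrightarrow> (L, X) \<in> mult below \<Longrightarrow> conv_below X a b"
  unfolding conv_below_def using conv_single by fastforce

text \<open>The bound concerns each label and not the total weight, so it survives concatenation and
  pieces can be bounded separately.\<close>

lemma conv_below_trans: "conv_below X a b \<Longrightarrow> conv_below X b c \<Longrightarrow> conv_below X a c"
  unfolding conv_below_def by (metis conv_trans union_iff)

lemma conv_below_sym: "conv_below X a b \<Longrightarrow> conv_below X b a"
  unfolding conv_below_def using conv_sym[OF sym_H] by blast

lemma conv_below_H:
  assumes "(d, e) \<in> H\<^sup>=" "x \<in># X" "(d, x) \<in> below" "y \<in># X" "(e, y) \<in> below"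
  shows "conv_below X d e"
proof (cases "d = e")
  case False
  with assms have "step H R {#d, e#} d e" by (auto intro: step.equational)
  moreover have "({#d, e#}, X) \<in> mult below"
    using assms by (intro label_below) auto
  ultimately show ?thesis by (rule conv_below_step)
qed (simp add: conv_below_refl)

lemma conv_below_steps:
  assumes "(c, d) \<in> (S \<union> R)\<^sup>*" "x \<in># X" "(c, x) \<in> below"
  shows "conv_below X c d"
  using assms(1)
proof (induction rule: rtrancl_induct)
  case base
  then show ?case by (rule conv_below_refl)
next
  case (step y z)
  have y: "(y, x) \<in> below" using step assms below_steps by blast
  have z: "(z, x) \<in> below"
    using below_steps[OF assms(3)] step by (meson rtrancl.rtrancl_into_rtrancl)
  have "conv_below X y z"
  proof (cases "(y, z) \<in> R")
    case True
    then show ?thesis using y assms(2)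
      by (intro conv_below_step[OF step.forward] label_below) auto
  next
    case False
    then have "(y, z) \<in> H" using step S_sub_H by auto
    then show ?thesis using conv_below_H y z assms(2) by blast
  qed
  then show ?case using step conv_below_trans by blast
qed

text \<open>The ends may lie below different elements of \<open>X\<close>: for a peak both lie below
  its top, for a cliff one lies below each end of the \<open>H\<close>-step.\<close>

lemma conv_below_valley:
  assumes "(a, b) \<in> (S \<union> R)\<^sup>* O H\<^sup>= O ((S \<union> R)\<inverse>)\<^sup>*"
    and "x \<in># X" "(a, x) \<in> below" "y \<in># X" "(b, y) \<in> below"
  shows "conv_below X a b"
proof -
  from assms(1) obtain d e where de: "(a, d) \<in> (S \<union> R)\<^sup>*" "(d, e) \<in> H\<^sup>=" "(b, e) \<in> (S \<union> R)\<^sup>*"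
    by (auto simp only: relcomp_unfold rtrancl_converse converse_iff mem_Collect_eq case_prod_conv)
  have "conv_below X a d" using conv_below_steps de(1) assms(2,3) .
  moreover have "conv_below X d e"
    using conv_below_H de assms(2-) below_steps by blast
  moreover have "conv_below X e b"
    using conv_below_sym[OF conv_below_steps] de(3) assms(4,5) by blast
  ultimately show ?thesis using conv_below_trans by blast
qed

section \<open>Lighter conversions and normal forms\<close>

definition reducible :: "'a multiset multiset \<Rightarrow> 'a \<Rightarrow> 'a \<Rightarrow> bool" where
  "reducible M a b \<longleftrightarrow> (\<exists>M'. (M', M) \<in> below_weight \<and> conv H R M' a b)"

text \<open>One label \<open>X\<close> of the old conversion outweighs any number of labels below
  it.\<close>

lemma reducible_if_conv_below: "conv_below X a b \<Longrightarrow> X \<in># N \<Longrightarrow> reducible N a b"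
  unfolding conv_below_def reducible_def using weight_below by (metis empty_iff set_mset_empty)

lemma reducible_append: "reducible M a b \<Longrightarrow> conv H R N b c \<Longrightarrow> reducible (M + N) a c"
  unfolding reducible_def using conv_trans below_weight_add by metis

lemma reducible_step:
  assumes "step H R L a b" "reducible M b c"
  shows "reducible (add_mset L M) a c"
proof -
  from assms(2) obtain M' where "(M', M) \<in> below_weight" "conv H R M' b c"
    unfolding reducible_def by blast
  then show ?thesis
    unfolding reducible_def
    using below_weight_add[of M' M "{#L#}"] conv.step[OF assms(1)] by auto
qed

lemma reducible_sym: "reducible M a b \<Longrightarrow> reducible M b a"
  unfolding reducible_def using conv_sym[OF sym_H] by blast

lemma reducible_peak:
  assumes "(a, b) \<in> R" "(a, c) \<in> R"
  shows "reducible {#{#a#}, {#a#}#} b c"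
proof (rule reducible_if_conv_below)
  show "conv_below {#a#} b c"
    by (rule conv_below_valley) (use assms peak R_below in auto)
qed simp

text \<open>The bound is the label of the \<open>H\<close>-step. Its two-element form matters: the
  new conversion may again start at \<open>a\<close>, so \<open>a\<close> can recur in a label, and
  the decrease then comes from \<open>b\<close>.\<close>

lemma reducible_cliff:
  assumes "(a, b) \<in> H" "(b, c) \<in> R"
  shows "reducible {#{#a, b#}, {#b#}#} a c"
proof (rule reducible_if_conv_below)
  have c: "(c, b) \<in> below" using assms R_below by blast
  have "(a, c) \<in> H\<^sup>= O ((S \<union> R)\<inverse>)\<^sup>* \<or>
      (a, c) \<in> R O (S \<union> R)\<^sup>* O H\<^sup>= O ((S \<union> R)\<inverse>)\<^sup>*"
    using cliff assms by blast
  then show "conv_below {#a, b#} a c"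
  proof
    assume "(a, c) \<in> H\<^sup>= O ((S \<union> R)\<inverse>)\<^sup>*"
    then obtain d where d: "(a, d) \<in> H\<^sup>=" "(c, d) \<in> (S \<union> R)\<^sup>*"
      by (auto simp only: relcomp_unfold rtrancl_converse converse_iff mem_Collect_eq case_prod_conv)
    have "(d, b) \<in> below" using below_steps c d(2) .
    \<comment> \<open>Here \<open>a\<close> stays and \<open>b\<close> is exchanged for the smaller
      \<open>d\<close>.\<close>
    then have "({#a, d#}, {#a, b#}) \<in> mult below"
      using one_step_implies_mult[of "{#b#}" "{#d#}" below "{#a#}"]
      by (simp add: add_mset_commute)
    then have "conv_below {#a, b#} a d"
      using d(1) conv_below_refl conv_below_step[OF step.equational] by auto
    moreover have "conv_below {#a, b#} d c"
      by (rule conv_below_sym, rule conv_below_steps[OF d(2) _ c]) simp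
    ultimately show ?thesis by (rule conv_below_trans)
  next
    assume "(a, c) \<in> R O (S \<union> R)\<^sup>* O H\<^sup>= O ((S \<union> R)\<inverse>)\<^sup>*"
    then obtain a' where a': "(a, a') \<in> R" "(a', c) \<in> (S \<union> R)\<^sup>* O H\<^sup>= O ((S \<union> R)\<inverse>)\<^sup>*"
      by blast
    \<comment> \<open>Here \<open>b\<close> is exchanged for nothing.\<close>
    have "({#a#}, {#a, b#}) \<in> mult below"
      using one_step_implies_mult[of "{#b#}" "{#}" below "{#a#}"]
      by (simp add: add_mset_commute)
    then have "conv_below {#a, b#} a a'"
      using a'(1) conv_below_step[OF step.forward] by blast
    moreover have "conv_below {#a, b#} a' c"
      by (rule conv_below_valley[OF a'(2), of a _ b]) (use c R_below a' in auto)
    ultimately show ?thesis by (rule conv_below_trans)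
  qed
qed simp

text \<open>A prepended step can form a peak or cliff only with the first step of the conversion, so
  the induction remembers that step. After a leading \<open>R\<close>-step nothing is claimed about
  the rest; a leading \<open>H\<close>-step also carries the normal form, to which further
  \<open>H\<close>-steps can be prepended.\<close>

lemma conv_cases:
  assumes "conv H R M a b"
  shows "reducible M a b
    \<or> (\<exists>c N. M = add_mset {#a#} N \<and> (a, c) \<in> R \<and> conv H R N c b)
    \<or> ((\<exists>c N. M = add_mset {#a, c#} N \<and> (a, c) \<in> H \<and> conv H R N c b) \<and> (a, b) \<in> H\<^sup>* O (R\<inverse>)\<^sup>*)
    \<or> (a, b) \<in> (R\<inverse>)\<^sup>*"
  using assms
proof (induction rule: conv.induct)
  case (refl a)
  then show ?case by simp
next
  case (step L a b M c)
  from step.IH consider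
    (reducible) "reducible M b c"
    | (R) d N where "M = add_mset {#b#} N" "(b, d) \<in> R" "conv H R N d c"
    | (H) d N where "M = add_mset {#b, d#} N" "(b, d) \<in> H" "conv H R N d c"
        "(b, c) \<in> H\<^sup>* O (R\<inverse>)\<^sup>*"
    | (R_inv) "(b, c) \<in> (R\<inverse>)\<^sup>*"
    by blast
  then show ?case
  proof cases
    case reducible
    then show ?thesis using reducible_step step.hyps by blast
  next
    case R
    from step.hyps(1) show ?thesis
    proof cases
      case forward
      then show ?thesis using step.hyps by blast
    next
      case backward
      then have "reducible {#{#b#}, {#b#}#} a d" using R reducible_peak by blast
      then show ?thesis using reducible_append[OF _ R(3)] R(1) backward by fastforce
    next
      case equational
      then have "reducible {#{#a, b#}, {#b#}#} a d" using R reducible_cliff by blast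
      then show ?thesis using reducible_append[OF _ R(3)] R(1) equational by fastforce
    qed
  next
    case H
    from step.hyps(1) show ?thesis
    proof cases
      case forward
      then show ?thesis using step.hyps by blast
    next
      case backward
      \<comment> \<open>Read from right to left, the backward step followed by the
        \<open>H\<close>-step is a cliff from \<open>d\<close> over \<open>b\<close> to
        \<open>a\<close>.\<close>
      have "reducible {#{#d, b#}, {#b#}#} d a"
        using H(2) backward sym_H reducible_cliff by (meson symD)
      then have "reducible {#{#b#}, {#b, d#}#} a d"
        using reducible_sym by (simp add: add_mset_commute)
      then show ?thesis using reducible_append[OF _ H(3)] H(1) backward by fastforce
    next
      case equational
      then have "(a, c) \<in> H\<^sup>* O (R\<inverse>)\<^sup>*"
        using H(4) by (auto intro: converse_rtrancl_into_rtrancl)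
      then show ?thesis using equational step.hyps by blast
    qed
  next
    case R_inv
    from step.hyps(1) show ?thesis
    proof cases
      case forward
      then show ?thesis using step.hyps by blast
    next
      case backward
      then have "(a, c) \<in> (R\<inverse>)\<^sup>*" using R_inv by (simp add: converse_rtrancl_into_rtrancl)
      then show ?thesis by blast
    next
      case equational
      then have "(a, c) \<in> H\<^sup>* O (R\<inverse>)\<^sup>*" using R_inv by blast
      then show ?thesis using equational step.hyps by blast
    qed
  qed
qed

text \<open>Splitting off a leading \<open>R\<close>-step deletes its label and so lowers the
  weight, just as a reduction does; the steps split off make up the \<open>R\<^sup>*\<close> prefix.
  The last two alternatives of \<open>conv_cases\<close> both end the recursion.\<close>

lemma conv_imp_valley: "conv H R M a b \<Longrightarrow> (a, b) \<in> R\<^sup>* O H\<^sup>* O (R\<inverse>)\<^sup>*"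
proof (induction M arbitrary: a b rule: wf_induct_rule[OF wf_below_weight])
  case (1 M)
  from conv_cases[OF 1(2)] consider
    (smaller) M' where "(M', M) \<in> below_weight" "conv H R M' a b"
    | (R) c N where "M = add_mset {#a#} N" "(a, c) \<in> R" "conv H R N c b"
    | (normal) "(a, b) \<in> H\<^sup>* O (R\<inverse>)\<^sup>*"
    unfolding reducible_def by blast
  then show ?case
  proof cases
    case smaller
    then show ?thesis using 1(1) by blast
  next
    case R
    have "(N, M) \<in> below_weight"
      using one_step_implies_mult[of "{#{#a#}#}" "{#}" "mult below" N] R(1) by simp
    then have "(c, b) \<in> R\<^sup>* O H\<^sup>* O (R\<inverse>)\<^sup>*" using 1(1) R(3) by blast
    then show ?thesis using R(2) by (auto intro: converse_rtrancl_into_rtrancl)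
  next
    case normal
    then show ?thesis by blast
  qed
qed

lemma church_rosser: "church_rosser_modulo R (H\<^sup>*)"
  unfolding church_rosser_modulo_def
  using conv_if_convertible conv_imp_valley by (metis subrelI)

end

theorem theorem2p2:
  fixes H R S :: "('a \<times> 'a) set"
  assumes "sym H"
    and "S \<subseteq> H"
    and "well_founded (R O S\<^sup>*)"
    and "R\<inverse> O R \<subseteq> (S \<union> R)\<^sup>* O H\<^sup>= O ((S \<union> R)\<inverse>)\<^sup>*"
    and "H O R \<subseteq> (H\<^sup>= O ((S \<union> R)\<inverse>)\<^sup>*) \<union> (R O (S \<union> R)\<^sup>* O H\<^sup>= O ((S \<union> R)\<inverse>)\<^sup>*)"
  shows "church_rosser_modulo R (H\<^sup>*)"
proof -
  interpret peaks_and_cliffs H R S by unfold_locales fact+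
  show ?thesis by (rule church_rosser)
qed

end
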